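(* For any fair, rejection-invariant dual bin packing algorithm $\textsc{Alg}$, the online bounded ratio of $\textsc{Alg}$ equals the competitive ratio of $\textsc{Alg}$ on accommodating sequences.
   Context: Dual bin packing: there are $n$ bins of capacity $1$; items with sizes in $(0,1]$ arrive online and each must be irrevocably either rejected or placed in a bin with enough remaining capacity; the goal is to maximize the number of packed items. An accommodating sequence is one for which an optimal offline algorithm $\textsc{Opt}$ packs all items. An algorithm is fair if it never rejects an item that fits in some bin, and rejection-invariant if its behavior does not depend on rejected items. The competitive ratio of $\textsc{Alg}$ on accommodating sequences is the supremum of all $c$ for which there is a constant $\alpha$ with $\textsc{Alg}(I)\ge c\,\textsc{Opt}(I)-\alpha$ for all accommodating sequences $I$. $\textsc{Opt}_{\textsc{Alg}}$ denotes an offline algorithm that is optimal among offline algorithms whose packing of any input $I$ satisfies, for every prefix $I'$ of $I$, that it packs at least $\textsc{Alg}(I')$ items of $I'$; the (asymptotic) online bounded ratio of $\textsc{Alg}$ is the supremum of all $c$ for which there is a constant $\alpha$ with $\textsc{Alg}(I)\ge c\,\textsc{Opt}_{\textsc{Alg}}(I)-\alpha$ for all input sequences $I$. *)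

theory Defs
  imports Complex_Main "HOL-Library.Extended_Real"
begin

section \<open>Dual bin packing\<close>

text \<open>
  Input sequences are lists of item sizes.  The bins are numbered from 0 to \<open>n - 1\<close>.  A packing
  of an input records for every item either the bin it is put into or \<open>None\<close> if it is rejected.
\<close>

type_synonym packing = "nat option list"

definition valid_input :: "real list \<Rightarrow> bool" where
  "valid_input I \<longleftrightarrow> (\<forall>x\<in>set I. 0 < x \<and> x \<le> 1)"

definition load :: "real list \<Rightarrow> packing \<Rightarrow> nat \<Rightarrow> real" where
  "load I p b = (\<Sum>i | i < length I \<and> p ! i = Some b. I ! i)"

definition num_packed :: "packing \<Rightarrow> nat" where
  "num_packed p = card {i. i < length p \<and> p ! i \<noteq> None}"

text \<open>
  Item sizes are positive, so bounding the final loads bounds the loads at every earlier time too.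
\<close>

definition feasible :: "nat \<Rightarrow> real list \<Rightarrow> packing \<Rightarrow> bool" where
  "feasible n I p \<longleftrightarrow>
     length p = length I \<and>
     (\<forall>i<length I. \<forall>b. p ! i = Some b \<longrightarrow> b < n) \<and>
     (\<forall>b<n. load I p b \<le> 1)"


section \<open>Online algorithms\<close>

text \<open>
  A (deterministic) online algorithm maps the list of items seen so far and the current item to
  its decision on the current item.  Its own earlier decisions are determined by the items seen
  so far, hence need not be passed as an argument.
\<close>

type_synonym online_alg = "real list \<Rightarrow> real \<Rightarrow> nat option"

definition online_packing :: "online_alg \<Rightarrow> real list \<Rightarrow> packing" where
  "online_packing alg I = map (\<lambda>i. alg (take i I) (I ! i)) [0..<length I]"

definition online_algorithm :: "nat \<Rightarrow> online_alg \<Rightarrow> bool" where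
  "online_algorithm n alg \<longleftrightarrow> (\<forall>I. valid_input I \<longrightarrow> feasible n I (online_packing alg I))"

definition fair :: "nat \<Rightarrow> online_alg \<Rightarrow> bool" where
  "fair n alg \<longleftrightarrow>
     (\<forall>I x. valid_input (I @ [x]) \<longrightarrow>
        (\<exists>b<n. load I (online_packing alg I) b + x \<le> 1) \<longrightarrow> alg I x \<noteq> None)"

text \<open>
  Deleting a rejected item \<open>x\<close> from the input changes none of the decisions on the items \<open>y\<close>
  arriving after it (those on earlier items cannot change anyway).
\<close>

definition rejection_invariant :: "online_alg \<Rightarrow> bool" where
  "rejection_invariant alg \<longleftrightarrow>
     (\<forall>I x J y. valid_input (I @ [x] @ J @ [y]) \<longrightarrow> alg I x = None \<longrightarrow>
        alg (I @ [x] @ J) y = alg (I @ J) y)"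


section \<open>Offline algorithms\<close>

type_synonym offline_alg = "real list \<Rightarrow> packing"

definition offline_algorithm :: "nat \<Rightarrow> offline_alg \<Rightarrow> bool" where
  "offline_algorithm n B \<longleftrightarrow> (\<forall>I. valid_input I \<longrightarrow> feasible n I (B I))"

definition optimal_among :: "offline_alg set \<Rightarrow> offline_alg \<Rightarrow> bool" where
  "optimal_among A B \<longleftrightarrow>
     B \<in> A \<and> (\<forall>C\<in>A. \<forall>I. valid_input I \<longrightarrow> num_packed (C I) \<le> num_packed (B I))"

definition is_Opt :: "nat \<Rightarrow> offline_alg \<Rightarrow> bool" where
  "is_Opt n Opt \<longleftrightarrow> optimal_among {B. offline_algorithm n B} Opt"

definition online_bounded :: "online_alg \<Rightarrow> offline_alg \<Rightarrow> bool" where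
  "online_bounded alg B \<longleftrightarrow>
     (\<forall>I. valid_input I \<longrightarrow>
        (\<forall>k\<le>length I. num_packed (online_packing alg (take k I)) \<le> num_packed (take k (B I))))"

definition is_Opt_Alg :: "nat \<Rightarrow> online_alg \<Rightarrow> offline_alg \<Rightarrow> bool" where
  "is_Opt_Alg n alg OptAlg \<longleftrightarrow>
     optimal_among {B. offline_algorithm n B \<and> online_bounded alg B} OptAlg"

lemma ex_optimal_among:
  assumes ex: "\<And>I. valid_input I \<Longrightarrow> \<exists>p. P I p"
    and len: "\<And>I p. P I p \<Longrightarrow> length p = length I"
  shows "\<exists>B. optimal_among {B. \<forall>I. valid_input I \<longrightarrow> P I (B I)} B"
proof -
  have "\<exists>p. valid_input I \<longrightarrow> P I p \<and> (\<forall>q. P I q \<longrightarrow> num_packed q \<le> num_packed p)" for I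
  proof (cases "valid_input I")
    case True
    then obtain p0 where p0: "P I p0" using ex by blast
    have bound: "\<forall>q. P I q \<longrightarrow> num_packed q < Suc (length I)"
    proof (intro allI impI)
      fix q assume "P I q"
      have "num_packed q \<le> card {..<length q}"
        unfolding num_packed_def by (rule card_mono) auto
      then show "num_packed q < Suc (length I)" using len[OF \<open>P I q\<close>] by simp
    qed
    obtain p where "P I p" "\<forall>q. P I q \<longrightarrow> num_packed q \<le> num_packed p"
      using ex_has_greatest_nat[where P = "P I" and f = num_packed, OF p0 bound] by blast
    then show ?thesis by blast
  qed simp
  then have "\<exists>B. \<forall>I. valid_input I \<longrightarrow>
      P I (B I) \<and> (\<forall>q. P I q \<longrightarrow> num_packed q \<le> num_packed (B I))"
    by (intro choice allI)
  then obtain B where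
    B: "\<forall>I. valid_input I \<longrightarrow> P I (B I) \<and> (\<forall>q. P I q \<longrightarrow> num_packed q \<le> num_packed (B I))" ..
  have "optimal_among {B. \<forall>I. valid_input I \<longrightarrow> P I (B I)} B"
    unfolding optimal_among_def using B by simp
  then show ?thesis by (rule exI[where x = B])
qed

lemma ex_is_Opt: "\<exists>Opt. is_Opt n Opt"
proof -
  have "feasible n I (replicate (length I) None)" for I
  proof -
    have no: "{i. i < length I \<and> replicate (length I) None ! i = Some b} = {}" for b :: nat
      by auto
    show ?thesis by (simp add: feasible_def load_def no)
  qed
  then have ex: "\<exists>p. feasible n I p" for I by (rule exI)
  have "\<exists>B. optimal_among {B. \<forall>I. valid_input I \<longrightarrow> feasible n I (B I)} B"
  proof (rule ex_optimal_among)
    show "\<exists>p. feasible n I p" for I by (rule ex)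
  qed (simp add: feasible_def)
  then show ?thesis by (simp add: is_Opt_def offline_algorithm_def)
qed

lemma take_online_packing: "take k (online_packing alg I) = online_packing alg (take k I)"
proof -
  have "take k (online_packing alg I) =
      map (\<lambda>i. alg (take i I) (I ! i)) [0..<length (take k I)]"
    by (simp add: online_packing_def take_map min_def)
  also have "\<dots> = online_packing alg (take k I)"
    unfolding online_packing_def by (rule map_cong) auto
  finally show ?thesis .
qed

lemma ex_is_Opt_Alg:
  assumes "online_algorithm n alg"
  shows "\<exists>OptAlg. is_Opt_Alg n alg OptAlg"
proof -
  let ?P = "\<lambda>I p. feasible n I p \<and>
    (\<forall>k\<le>length I. num_packed (online_packing alg (take k I)) \<le> num_packed (take k p))"
  have "\<exists>B. optimal_among {B. \<forall>I. valid_input I \<longrightarrow> ?P I (B I)} B"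
  proof (rule ex_optimal_among)
    fix I assume "valid_input I"
    then have "?P I (online_packing alg I)"
      using assms by (simp add: online_algorithm_def take_online_packing)
    then show "\<exists>p. ?P I p" by blast
  qed (simp add: feasible_def)
  moreover have "{B. \<forall>I. valid_input I \<longrightarrow> ?P I (B I)} =
      {B. offline_algorithm n B \<and> online_bounded alg B}"
    by (auto simp: offline_algorithm_def online_bounded_def)
  ultimately show ?thesis by (simp add: is_Opt_Alg_def)
qed


section \<open>Performance ratios\<close>

definition accommodating :: "offline_alg \<Rightarrow> real list \<Rightarrow> bool" where
  "accommodating Opt I \<longleftrightarrow> valid_input I \<and> num_packed (Opt I) = length I"

text \<open>
  The suprema are taken in the extended reals, so they are meaningful even in the degenerate case
  of no bins, where every real number \<open>c\<close> qualifies.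
\<close>

definition accommodating_ratio :: "online_alg \<Rightarrow> offline_alg \<Rightarrow> ereal" where
  "accommodating_ratio alg Opt =
     Sup {ereal c | c. \<exists>\<alpha>. \<forall>I. accommodating Opt I \<longrightarrow>
       real (num_packed (online_packing alg I)) \<ge> c * real (num_packed (Opt I)) - \<alpha>}"

definition online_bounded_ratio :: "online_alg \<Rightarrow> offline_alg \<Rightarrow> ereal" where
  "online_bounded_ratio alg OptAlg =
     Sup {ereal c | c. \<exists>\<alpha>. \<forall>I. valid_input I \<longrightarrow>
       real (num_packed (online_packing alg I)) \<ge> c * real (num_packed (OptAlg I)) - \<alpha>}"

end

theory Submission
  imports Defs
begin

text \<open>
  On an accommodating sequence the online bounded optimum packs everything, just as the optimum
  does.  Conversely, let the online bounded optimum pack the set \<open>B\<close> of items and the algorithm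
  the set \<open>A\<close>.  Take the earliest item \<open>x \<in> A - B\<close>.  As the optimum is never behind, some
  \<open>y \<in> B - A\<close> precedes \<open>x\<close>; by fairness \<open>y\<close> did not fit when it arrived, whereas \<open>x\<close> did fit
  later, so \<open>x < y\<close> and \<open>x\<close> can replace \<open>y\<close> in the optimum's packing.  Repeating this leads to
  \<open>A \<subseteq> B\<close> with \<open>card B\<close> unchanged.  The subsequence of the items in \<open>B\<close> is then accommodating, and
  by rejection invariance the algorithm still packs exactly \<open>A\<close> on it.
\<close>

section \<open>Packed items, loads and prefixes\<close>

definition packed_items :: "packing \<Rightarrow> nat set" where
  "packed_items p = {i. i < length p \<and> p ! i \<noteq> None}"

text \<open>Zipping keeps each decision attached to its item: the second components of the same
  filtered list are a packing of the subsequence. The form also commutes with appending an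
  item.\<close>

definition packed_sublist :: "real list \<Rightarrow> packing \<Rightarrow> real list" where
  "packed_sublist I p = map fst (filter (\<lambda>(x, d). d \<noteq> None) (zip I p))"

lemma finite_packed_items [simp]: "finite (packed_items p)"
  by (simp add: packed_items_def)

lemma num_packed_eq_card: "num_packed p = card (packed_items p)"
  by (simp add: num_packed_def packed_items_def)

lemma num_packed_eq_length_filter: "num_packed p = length (filter (\<lambda>d. d \<noteq> None) p)"
  by (simp add: num_packed_def length_filter_conv_card)

lemma num_packed_le_length: "num_packed p \<le> length p"
  by (simp add: num_packed_eq_length_filter)

lemma num_packed_take:
  "k \<le> length p \<Longrightarrow> num_packed (take k p) = card (packed_items p \<inter> {..<k})"
  unfolding num_packed_def packed_items_def by (rule arg_cong[where f = card]) auto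

lemma num_packed_take_all:
  assumes "num_packed p = length p"
  shows "num_packed (take k p) = length (take k p)"
proof -
  have "\<forall>d\<in>set p. d \<noteq> None"
    using assms length_filter_less[of _ p "\<lambda>d. d \<noteq> None"]
    by (fastforce simp: num_packed_eq_length_filter)
  then have "filter (\<lambda>d. d \<noteq> None) (take k p) = take k p"
    by (intro filter_True) (blast dest: in_set_takeD)
  then show ?thesis by (simp add: num_packed_eq_length_filter)
qed

lemma length_online_packing [simp]: "length (online_packing alg I) = length I"
  by (simp add: online_packing_def)

lemma online_packing_nth:
  "i < length I \<Longrightarrow> online_packing alg I ! i = alg (take i I) (I ! i)"
  by (simp add: online_packing_def)

lemma online_packing_Nil [simp]: "online_packing alg [] = []"
  by (simp add: online_packing_def)

lemma online_packing_snoc: "online_packing alg (I @ [x]) = online_packing alg I @ [alg I x]"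
  by (rule nth_equalityI) (auto simp: online_packing_def nth_append)

lemma load_snoc:
  assumes "length p = length I"
  shows "load (I @ [x]) (p @ [d]) b = load I p b + (if d = Some b then x else 0)"
proof -
  have "{i. i < length (I @ [x]) \<and> (p @ [d]) ! i = Some b} =
      {i. i < length I \<and> p ! i = Some b} \<union> (if d = Some b then {length I} else {})"
    using assms by (auto simp: nth_append less_Suc_eq split: if_splits)
  moreover have "(\<Sum>i | i < length I \<and> p ! i = Some b. (I @ [x]) ! i) = load I p b"
    unfolding load_def by (rule sum.cong) (auto simp: nth_append)
  ultimately show ?thesis by (auto simp: load_def)
qed

text \<open>An index-free form of the load, in which positions that shift when rejected items are
  deleted do not matter.\<close>

lemma load_eq_sum_list:
  "length p = length I \<Longrightarrow>
    load I p b = sum_list (map fst (filter (\<lambda>(x, d). d = Some b) (zip I p)))"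
proof (induction I arbitrary: p rule: rev_induct)
  case Nil
  then show ?case by (simp add: load_def)
next
  case (snoc x I)
  then obtain q d where "p = q @ [d]" "length q = length I"
    by (cases p rule: rev_cases) auto
  with snoc.IH[of q] show ?case by (simp add: load_snoc)
qed

lemma load_take_mono:
  assumes "valid_input I" "j \<le> i" "i \<le> length I"
  shows "load (take j I) (take j p) b \<le> load (take i I) (take i p) b"
proof -
  have "load (take k I) (take k p) b = (\<Sum>m | m < k \<and> p ! m = Some b. I ! m)"
    if "k \<le> length I" for k
    unfolding load_def using that by (intro sum.cong) auto
  moreover have "(\<Sum>m | m < j \<and> p ! m = Some b. I ! m) \<le> (\<Sum>m | m < i \<and> p ! m = Some b. I ! m)"
    proof (rule sum_mono2)
    show "0 \<le> I ! m"
      if "m \<in> {m. m < i \<and> p ! m = Some b} - {m. m < j \<and> p ! m = Some b}" for m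
    proof -
      have "I ! m \<in> set I" using that assms(3) by simp
      then show ?thesis using assms(1) by (auto simp: valid_input_def)
    qed
  qed (use assms(2) in auto)
  ultimately show ?thesis using assms by simp
qed

lemma valid_input_subset: "valid_input I \<Longrightarrow> set J \<subseteq> set I \<Longrightarrow> valid_input J"
  by (auto simp: valid_input_def)

section \<open>Consequence of fairness\<close>

text \<open>Consider the bin that receives item \<open>i\<close>. By fairness item \<open>j\<close>
  would already have overflowed it, and its load can only have grown since. As item \<open>i\<close>
  still fits, it is no larger.\<close>

lemma fair_accepted_le_rejected:
  assumes on: "online_algorithm n alg" and "fair n alg" and val: "valid_input I"
    and "j < i" "i < length I"
    and acc: "online_packing alg I ! i \<noteq> None" and rej: "online_packing alg I ! j = None"
  shows "I ! i \<le> I ! j"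
proof -
  let ?p = "online_packing alg I"
  have val': "valid_input (take k I)" for k
    using val by (rule valid_input_subset) (rule set_take_subset)
  from acc obtain b where b: "?p ! i = Some b" by blast
  have p: "take (Suc i) ?p = take i ?p @ [Some b]"
    using b \<open>i < length I\<close> by (simp add: take_Suc_conv_app_nth)
  \<comment> \<open>\<open>feasible\<close> bounds final loads only, so it is applied to the input
    cut off just after item \<open>i\<close>; splitting off that item leaves the load at its
    arrival.\<close>
  have "feasible n (take (Suc i) I) (take (Suc i) ?p)"
    using on val'[of "Suc i"] by (simp add: online_algorithm_def take_online_packing)
  moreover have "i < length (take (Suc i) I)" using \<open>i < length I\<close> by simp
  moreover have "take (Suc i) ?p ! i = Some b" using b by simp
  ultimately have "b < n" "load (take (Suc i) I) (take (Suc i) ?p) b \<le> 1"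
    unfolding feasible_def by blast+
  then have "load (take i I) (take i ?p) b + I ! i \<le> 1"
    unfolding p using \<open>i < length I\<close> by (simp add: take_Suc_conv_app_nth load_snoc)
  moreover have "load (take j I) (take j ?p) b \<le> load (take i I) (take i ?p) b"
    using val assms(4,5) by (intro load_take_mono) auto
  moreover have "load (take j I) (take j ?p) b + I ! j > 1"
  proof (rule ccontr)
    assume "\<not> ?thesis"
    moreover have "valid_input (take j I @ [I ! j])"
      using val'[of "Suc j"] assms(4,5) by (simp add: take_Suc_conv_app_nth)
    ultimately have "alg (take j I) (I ! j) \<noteq> None"
      using \<open>fair n alg\<close> \<open>b < n\<close> unfolding fair_def by (auto simp: take_online_packing not_less)
    then show False using rej assms(4,5) by (simp add: online_packing_nth)
  qed
  ultimately show ?thesis by linarith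
qed

section \<open>Exchanging items in an offline packing\<close>

text \<open>Only the former bin of \<open>y\<close> is affected, and its load changes by
  \<open>I ! x - I ! y\<close>, which is at most 0.\<close>

lemma feasible_swap:
  assumes feas: "feasible n I p" and x: "x < length I" "p ! x = None"
    and y: "y < length I" "p ! y \<noteq> None" and le: "I ! x \<le> I ! y"
  shows "feasible n I (p[y := None, x := p ! y])"
    and "packed_items (p[y := None, x := p ! y]) = insert x (packed_items p - {y})"
proof -
  have len: "length p = length I" using feas by (simp add: feasible_def)
  have "x \<noteq> y" using x y by auto
  define q where "q = p[y := None, x := p ! y]"
  have lenq: "length q = length I" using len by (simp add: q_def)
  have nth: "q ! i = (if i = x then p ! y else if i = y then None else p ! i)"
    if "i < length I" for i
    using that len \<open>x \<noteq> y\<close> by (auto simp: q_def nth_list_update)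
  have "packed_items q = insert x (packed_items p - {y})"
    using len lenq nth x y by (auto simp: packed_items_def split: if_splits)
  then show "packed_items (p[y := None, x := p ! y]) = insert x (packed_items p - {y})"
    unfolding q_def .
  have "load I q b \<le> load I p b" for b
  proof (cases "p ! y = Some b")
    case True
    let ?S = "{i. i < length I \<and> p ! i = Some b}"
    have "{i. i < length I \<and> q ! i = Some b} = insert x (?S - {y})"
      using nth x y True by (auto split: if_splits)
    then have "load I q b = I ! x + (\<Sum>i\<in>?S - {y}. I ! i)"
      using x by (simp add: load_def)
    also have "\<dots> \<le> I ! y + (\<Sum>i\<in>?S - {y}. I ! i)" using le by simp
    also have "\<dots> = load I p b"
      unfolding load_def using True y by (subst sum.remove[of ?S y]) auto
    finally show ?thesis .
  next
    case False
    then have "{i. i < length I \<and> q ! i = Some b} = {i. i < length I \<and> p ! i = Some b}"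
      using nth x y by (auto split: if_splits)
    then show ?thesis by (simp add: load_def)
  qed
  moreover have "b < n" if "i < length I" "q ! i = Some b" for i b
    using that feas nth[of i] y unfolding feasible_def by (auto split: if_splits)
  ultimately have "feasible n I q"
    using feas lenq unfolding feasible_def by (meson order_trans)
  then show "feasible n I (p[y := None, x := p ! y])" unfolding q_def .
qed

text \<open>Each exchange packs a missing item of \<open>A\<close> and evicts an item outside
  \<open>A\<close>, so induction on the number of missing items works. The prefix counts must
  survive each exchange, since they provide the next item to evict.\<close>

lemma ex_feasible_superset:
  assumes "feasible n I p"
    and "A \<subseteq> {..<length I}"
    and "\<And>i j. j < i \<Longrightarrow> i \<in> A \<Longrightarrow> j \<notin> A \<Longrightarrow> I ! i \<le> I ! j"
    and "\<And>k. k \<le> length I \<Longrightarrow> card (A \<inter> {..<k}) \<le> card (packed_items p \<inter> {..<k})"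
  shows "\<exists>q. feasible n I q \<and> A \<subseteq> packed_items q \<and> num_packed q = num_packed p"
  using assms
proof (induction "card (A - packed_items p)" arbitrary: p rule: less_induct)
  case less
  note feas = less.prems(1) and A = less.prems(2) and small = less.prems(3)
    and ahead = less.prems(4)
  have finA: "finite A" using A by (rule finite_subset) simp
  have len: "length p = length I" using feas by (simp add: feasible_def)
  show ?case
  proof (cases "A \<subseteq> packed_items p")
    case True
    with feas show ?thesis by blast
  next
    case False
    define x where "x = Min (A - packed_items p)"
    have x: "x \<in> A" "x \<notin> packed_items p"
      using Min_in[of "A - packed_items p"] False finA unfolding x_def by auto
    have first: "i \<in> packed_items p" if "i \<in> A" "i < x" for i
      proof (rule ccontr)
      assume "i \<notin> packed_items p"
      then have "x \<le> i" using that finA unfolding x_def by (intro Min_le) auto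
      with that show False by simp
    qed
    have xI: "x < length I" using x A by auto
    have "\<exists>y. y < x \<and> y \<in> packed_items p \<and> y \<notin> A"
    proof (rule ccontr)
      assume "\<not> ?thesis"
      \<comment> \<open>Up to and including position \<open>x\<close>, every packed item would lie
        in \<open>A\<close>, while \<open>x\<close> itself is in \<open>A\<close> but unpacked; so
        \<open>p\<close> would be behind on the prefix of length \<open>Suc x\<close>.\<close>
      then have "packed_items p \<inter> {..<Suc x} \<subset> A \<inter> {..<Suc x}"
        using x by (auto simp: less_Suc_eq)
      then have "card (packed_items p \<inter> {..<Suc x}) < card (A \<inter> {..<Suc x})"
        by (intro psubset_card_mono) auto
      with ahead[of "Suc x"] xI show False by simp
    qed
    then obtain y where y: "y < x" "y \<in> packed_items p" "y \<notin> A" by blast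
    define q where "q = p[y := None, x := p ! y]"
    have px: "p ! x = None" using x xI len by (auto simp: packed_items_def)
    have py: "y < length I" "p ! y \<noteq> None" using y len by (auto simp: packed_items_def)
    have feas_q: "feasible n I q" and items_q: "packed_items q = insert x (packed_items p - {y})"
      using feasible_swap[OF feas xI px py small[OF y(1) x(1) y(3)]] unfolding q_def by auto
    have "num_packed q = num_packed p"
      using x y card_Suc_Diff1[of "packed_items p" y] by (simp add: num_packed_eq_card items_q)
    moreover have "card (A - packed_items q) < card (A - packed_items p)"
      using x y finA by (intro psubset_card_mono) (auto simp: items_q)
    \<comment> \<open>A prefix containing \<open>y\<close> but not \<open>x\<close> loses an item,
      yet by minimality of \<open>x\<close> all items of \<open>A\<close> in it are still packed. A
      prefix reaching past \<open>x\<close> loses one item and gains one.\<close>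
    moreover have "card (A \<inter> {..<k}) \<le> card (packed_items q \<inter> {..<k})" if k: "k \<le> length I" for k
    proof (cases "k \<le> x")
      case True
      then have "A \<inter> {..<k} \<subseteq> packed_items q \<inter> {..<k}"
        using first y by (auto simp: items_q)
      then show ?thesis by (intro card_mono) auto
    next
      case False
      then have "packed_items q \<inter> {..<k} = insert x (packed_items p \<inter> {..<k} - {y})"
        using y by (auto simp: items_q)
      then have "card (packed_items q \<inter> {..<k}) = card (packed_items p \<inter> {..<k})"
        using x y False card_Suc_Diff1[of "packed_items p \<inter> {..<k}" y] by simp
      with ahead[OF k] show ?thesis by simp
    qed
    ultimately show ?thesis
      using less.hyps[OF _ feas_q A small] by auto
  qed
qed

section \<open>Deleting rejected items\<close>

text \<open>Rejected items contribute to no load, so the surviving decisions pack the whole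
  subsequence. This is what makes it accommodating.\<close>

lemma feasible_packed_sublist:
  assumes "feasible n I p"
  shows "\<exists>q. feasible n (packed_sublist I p) q \<and> num_packed q = length q \<and>
    length q = num_packed p"
proof -
  have len: "length p = length I" using assms by (simp add: feasible_def)
  define Z where "Z = filter (\<lambda>(x, d). d \<noteq> None) (zip I p)"
  define q where "q = map snd Z"
  have J: "packed_sublist I p = map fst Z" by (simp add: packed_sublist_def Z_def)
  have q: "q = filter (\<lambda>d. d \<noteq> None) p"
  proof -
    have "q = filter (\<lambda>d. d \<noteq> None) (map snd (zip I p))"
      unfolding q_def Z_def filter_map by (simp add: case_prod_unfold comp_def)
    then show ?thesis using len by simp
  qed
  have "load (map fst Z) q b = load I p b" for b
  proof -
    have "filter (\<lambda>(x, d). d = Some b) Z = filter (\<lambda>(x, d). d = Some b) (zip I p)"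
      unfolding Z_def filter_filter by (rule filter_cong) auto
    then show ?thesis
      using len by (simp add: load_eq_sum_list q_def zip_map_fst_snd)
  qed
  moreover have "b < n" if "i < length q" "q ! i = Some b" for i b
  proof -
    have "Some b \<in> set p" using that nth_mem[of i q] by (simp add: q)
    then show ?thesis using assms by (auto simp: feasible_def in_set_conv_nth)
  qed
  ultimately have "feasible n (packed_sublist I p) q"
    using assms by (auto simp: feasible_def J q_def)
  then show ?thesis by (auto simp: num_packed_eq_length_filter q)
qed

text \<open>
  Rejected items are deleted from the last one to the first, so that each deleted item is still
  preceded by the original input when rejection invariance is applied to it.
\<close>

lemma rejection_invariant_packed_sublist:
  assumes inv: "rejection_invariant alg"
  shows "length p = length I \<Longrightarrow> valid_input (I @ K @ [y]) \<Longrightarrow>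
    packed_items (online_packing alg I) \<subseteq> packed_items p \<Longrightarrow>
    alg (I @ K) y = alg (packed_sublist I p @ K) y"
proof (induction I arbitrary: p K rule: rev_induct)
  case Nil
  then show ?case by (simp add: packed_sublist_def)
next
  case (snoc x I)
  then obtain q d where p: "p = q @ [d]" and len: "length q = length I"
    by (cases p rule: rev_cases) auto
  have sub: "i \<in> packed_items (online_packing alg I @ [alg I x]) \<Longrightarrow> i \<in> packed_items (q @ [d])" for i
    using snoc.prems(3) by (auto simp: p online_packing_snoc)
  have sub': "packed_items (online_packing alg I) \<subseteq> packed_items q"
  proof
    fix i assume "i \<in> packed_items (online_packing alg I)"
    then show "i \<in> packed_items q"
      using sub[of i] len by (auto simp: packed_items_def nth_append)
  qed
  have val: "valid_input (I @ [x] @ K @ [y])" using snoc.prems(2) by simp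
  show ?case
  proof (cases d)
    case None
    \<comment> \<open>The inclusion of packed items forces the algorithm to reject whatever
      \<open>p\<close> drops.\<close>
    then have "alg I x = None"
      using sub[of "length I"] len by (cases "alg I x") (auto simp: packed_items_def nth_append)
    then have "alg (I @ [x] @ K) y = alg (I @ K) y"
      using inv val unfolding rejection_invariant_def by blast
    also have "\<dots> = alg (packed_sublist I q @ K) y"
      using len sub' val by (intro snoc.IH) (auto simp: valid_input_def)
    finally show ?thesis using None len by (simp add: p packed_sublist_def)
  next
    case (Some b)
    \<comment> \<open>A kept item joins the untouched suffix, hence the generalisation over
      \<open>K\<close>.\<close>
    have "alg (I @ x # K) y = alg (packed_sublist I q @ x # K) y"
      using len sub' val by (intro snoc.IH) auto
    then show ?thesis using Some len by (simp add: p packed_sublist_def)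
  qed
qed

text \<open>A dropped item was rejected and counts for nothing; a kept one receives its original
  decision, by the previous lemma with an empty suffix.\<close>

lemma num_packed_online_packed_sublist:
  assumes inv: "rejection_invariant alg"
  shows "length p = length I \<Longrightarrow> valid_input I \<Longrightarrow>
    packed_items (online_packing alg I) \<subseteq> packed_items p \<Longrightarrow>
    num_packed (online_packing alg (packed_sublist I p)) = num_packed (online_packing alg I)"
proof (induction I arbitrary: p rule: rev_induct)
  case Nil
  then show ?case by (simp add: packed_sublist_def)
next
  case (snoc x I)
  then obtain q d where p: "p = q @ [d]" and len: "length q = length I"
    by (cases p rule: rev_cases) auto
  have sub: "i \<in> packed_items (online_packing alg I @ [alg I x]) \<Longrightarrow> i \<in> packed_items (q @ [d])" for i
    using snoc.prems(3) by (auto simp: p online_packing_snoc)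
  have sub': "packed_items (online_packing alg I) \<subseteq> packed_items q"
  proof
    fix i assume "i \<in> packed_items (online_packing alg I)"
    then show "i \<in> packed_items q"
      using sub[of i] len by (auto simp: packed_items_def nth_append)
  qed
  have IH: "num_packed (online_packing alg (packed_sublist I q)) =
      num_packed (online_packing alg I)"
    using len sub' snoc.prems(2) by (intro snoc.IH) (auto simp: valid_input_def)
  show ?case
  proof (cases d)
    case None
    then have "alg I x = None"
      using sub[of "length I"] len by (cases "alg I x") (auto simp: packed_items_def nth_append)
    moreover have "packed_sublist (I @ [x]) p = packed_sublist I q"
      using None len by (simp add: p packed_sublist_def)
    ultimately show ?thesis using IH
      by (simp add: online_packing_snoc num_packed_eq_length_filter)
  next
    case (Some b)
    have "alg I x = alg (packed_sublist I q) x"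
      using rejection_invariant_packed_sublist[OF inv len, of "[]" x] sub' snoc.prems(2) by simp
    moreover have "packed_sublist (I @ [x]) p = packed_sublist I q @ [x]"
      using Some len by (simp add: p packed_sublist_def)
    ultimately show ?thesis using IH
      by (simp add: online_packing_snoc num_packed_eq_length_filter)
  qed
qed

section \<open>Optimal offline algorithms\<close>

text \<open>Optimality compares whole algorithms, so a single packing \<open>q\<close> is tested by
  redefining \<open>Opt\<close> at \<open>I\<close> alone.\<close>

lemma is_Opt_ge:
  assumes "is_Opt n Opt" "valid_input I" "feasible n I q"
  shows "num_packed q \<le> num_packed (Opt I)"
proof -
  have "offline_algorithm n (Opt(I := q))"
    using assms by (auto simp: is_Opt_def optimal_among_def offline_algorithm_def)
  then have "num_packed ((Opt(I := q)) I) \<le> num_packed (Opt I)"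
    using assms unfolding is_Opt_def optimal_among_def by blast
  then show ?thesis by simp
qed

lemma is_Opt_Alg_ge:
  assumes "is_Opt_Alg n alg B" "valid_input I" "feasible n I q"
    and "\<And>k. k \<le> length I \<Longrightarrow>
      num_packed (online_packing alg (take k I)) \<le> num_packed (take k q)"
  shows "num_packed q \<le> num_packed (B I)"
proof -
  have "offline_algorithm n (B(I := q)) \<and> online_bounded alg (B(I := q))"
    using assms
    by (auto simp: is_Opt_Alg_def optimal_among_def offline_algorithm_def online_bounded_def)
  then have "num_packed ((B(I := q)) I) \<le> num_packed (B I)"
    using assms unfolding is_Opt_Alg_def optimal_among_def by blast
  then show ?thesis by simp
qed

text \<open>A packing without rejections is behind on no prefix, so the packing of
  \<open>Opt\<close> is a legal competitor of \<open>OptAlg\<close> on \<open>I\<close>.\<close>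

lemma OptAlg_accommodating:
  assumes "is_Opt n Opt" "is_Opt_Alg n alg OptAlg" "accommodating Opt I"
  shows "num_packed (OptAlg I) = num_packed (Opt I)"
proof (rule antisym)
  have val: "valid_input I" and all: "num_packed (Opt I) = length I"
    using assms(3) by (auto simp: accommodating_def)
  have feas: "feasible n I (Opt I)" "feasible n I (OptAlg I)"
    using assms(1,2) val
    by (auto simp: is_Opt_def is_Opt_Alg_def optimal_among_def offline_algorithm_def)
  have len: "length (Opt I) = length I" using feas by (simp add: feasible_def)
  show "num_packed (OptAlg I) \<le> num_packed (Opt I)"
    using is_Opt_ge[OF assms(1) val feas(2)] .
  show "num_packed (Opt I) \<le> num_packed (OptAlg I)"
  proof (rule is_Opt_Alg_ge[OF assms(2) val feas(1)])
    fix k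
    show "num_packed (online_packing alg (take k I)) \<le> num_packed (take k (Opt I))"
      using num_packed_take_all[of "Opt I" k] all len
        num_packed_le_length[of "online_packing alg (take k I)"] by simp
  qed
qed

section \<open>Reduction to accommodating sequences and equality of the ratios\<close>

text \<open>Since both counts are preserved exactly, any bound known on accommodating sequences
  carries over to \<open>I\<close> with the same constants.\<close>

lemma ex_accommodating_same_counts:
  assumes on: "online_algorithm n alg" and fair: "fair n alg" and inv: "rejection_invariant alg"
    and opt: "is_Opt n Opt" and optalg: "is_Opt_Alg n alg OptAlg" and val: "valid_input I"
  shows "\<exists>J. accommodating Opt J \<and> num_packed (Opt J) = num_packed (OptAlg I) \<and>
    num_packed (online_packing alg J) = num_packed (online_packing alg I)"
proof -
  define A where "A = packed_items (online_packing alg I)"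
  have feas: "feasible n I (OptAlg I)"
    and bounded: "\<And>k. k \<le> length I \<Longrightarrow>
      num_packed (online_packing alg (take k I)) \<le> num_packed (take k (OptAlg I))"
    using optalg val
    by (auto simp: is_Opt_Alg_def optimal_among_def offline_algorithm_def online_bounded_def)
  have "\<exists>q. feasible n I q \<and> A \<subseteq> packed_items q \<and> num_packed q = num_packed (OptAlg I)"
  proof (rule ex_feasible_superset[OF feas])
    show "A \<subseteq> {..<length I}" by (auto simp: A_def packed_items_def)
    show "I ! i \<le> I ! j" if "j < i" "i \<in> A" "j \<notin> A" for i j
      using that by (intro fair_accepted_le_rejected[OF on fair val])
        (auto simp: A_def packed_items_def)
    show "card (A \<inter> {..<k}) \<le> card (packed_items (OptAlg I) \<inter> {..<k})" if "k \<le> length I" for k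
      using bounded[OF that] that feas
      by (simp add: A_def feasible_def num_packed_take flip: take_online_packing)
  qed
  then obtain q where q: "feasible n I q" "A \<subseteq> packed_items q"
    "num_packed q = num_packed (OptAlg I)" by blast
  define J where "J = packed_sublist I q"
  have len: "length q = length I" using q by (simp add: feasible_def)
  have valJ: "valid_input J"
    using val by (rule valid_input_subset)
      (auto simp: J_def packed_sublist_def dest: set_zip_leftD)
  obtain r where r: "feasible n J r" "num_packed r = length r" "length r = num_packed q"
    using feasible_packed_sublist[OF q(1)] unfolding J_def by blast
  have "length (Opt J) = length J"
    using opt valJ
    by (simp add: is_Opt_def optimal_among_def offline_algorithm_def feasible_def)
  moreover have "length r = length J" using r by (simp add: feasible_def)
  \<comment> \<open>\<open>r\<close> packs all of \<open>J\<close>, so the optimum must as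
    well.\<close>
  ultimately have "num_packed (Opt J) = length J"
    using is_Opt_ge[OF opt valJ r(1)] r num_packed_le_length[of "Opt J"] by simp
  moreover have "num_packed (online_packing alg J) = num_packed (online_packing alg I)"
    using num_packed_online_packed_sublist[OF inv len val] q(2) by (simp add: A_def J_def)
  ultimately show ?thesis
    using valJ q(3) r \<open>length r = length J\<close> unfolding accommodating_def by metis
qed

theorem theorem11:
  fixes n :: nat and alg :: online_alg and Opt OptAlg :: offline_alg
  assumes "online_algorithm n alg"
    and "fair n alg"
    and "rejection_invariant alg"
    and "is_Opt n Opt"
    and "is_Opt_Alg n alg OptAlg"
  shows "online_bounded_ratio alg OptAlg = accommodating_ratio alg Opt"
proof -
  \<comment> \<open>The equivalence holds for each fixed \<open>c\<close> and
    \<open>\<alpha>\<close>, so the two sets of admissible \<open>c\<close> coincide, and with them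
    their suprema.\<close>
  have "(\<forall>I. valid_input I \<longrightarrow>
        real (num_packed (online_packing alg I)) \<ge> c * real (num_packed (OptAlg I)) - \<alpha>) \<longleftrightarrow>
      (\<forall>I. accommodating Opt I \<longrightarrow>
        real (num_packed (online_packing alg I)) \<ge> c * real (num_packed (Opt I)) - \<alpha>)"
    (is "?bounded \<longleftrightarrow> ?accommodating") for c \<alpha> :: real
  proof
    assume ?bounded
    then show ?accommodating
      using OptAlg_accommodating[OF assms(4,5)] by (metis accommodating_def)
  next
    assume ?accommodating
    then show ?bounded
      using ex_accommodating_same_counts[OF assms] by metis
  qed
  then show ?thesis by (simp add: online_bounded_ratio_def accommodating_ratio_def)
qed

end
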